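(* Let $p$ be a probability distribution on $\mathbb{R}^D$, let $x\in\mathbb{R}^D$ be fixed, and let $y,y_1,y_2,\dots$ be i.i.d. with distribution $p$. Let $w=k(x,y)$, and assume that for some constants $M,C>0$ one has $w\in[0,M]$ and $\|y\|\le C$ almost surely, that $\Pr(w>0)=1$, and that $\mathbb{E}[w]>0$. Let $T_n$ be the minibatch centroid and $T_n^{\mathrm{ABC}}$ the analytically bias-corrected (ABC) centroid of $y_1,\dots,y_n$. Then, as $n\to\infty$, $$\mathbb{E}\bigl[\|T_n^{\mathrm{ABC}}-\mathbb{E}[T_n^{\mathrm{ABC}}]\|^2\bigr]\;=\;\mathbb{E}\bigl[\|T_n-\mathbb{E}[T_n]\|^2\bigr]+O(n^{-3/2})\;=\;O(n^{-1}).$$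
   Context: $k:\mathbb{R}^D\times\mathbb{R}^D\to\mathbb{R}$ is a kernel (with $k(x,\cdot)$ measurable), and $\|\cdot\|$ is the Euclidean norm. With $w_i=k(x,y_i)$ and $\alpha_i=w_i/\sum_{j=1}^n w_j$ (well defined on the event $\sum_{j=1}^n w_j>0$, which has probability one under the hypotheses), the minibatch centroid is $T_n:=\sum_{i=1}^n\alpha_i y_i$, the plug-in correction is $\Delta_n:=\sum_{i=1}^n\alpha_i^2\,(T_n-y_i)$, and the ABC centroid is $$T_n^{\mathrm{ABC}}:=T_n-\Delta_n=\Bigl(1-\sum_{i=1}^n\alpha_i^2\Bigr)T_n+\sum_{i=1}^n\alpha_i^2\,y_i.$$ The distribution $p$, kernel $k$ and query $x$ do not depend on $n$; $O(\cdot)$ constants are independent of $n$, with bounds holding for all sufficiently large $n$. *)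

theory Defs
  imports "HOL-Probability.Probability" "HOL-Library.Landau_Symbols"
begin

text \<open>A minibatch is a sequence of points \<open>y 1, y 2, \<dots>\<close>, of which the first \<open>n\<close> are used.
  If the normalising sum vanishes (a null event in the intended setting), all weights are \<open>0\<close> by
  the convention for division by zero.\<close>

definition batch_weight ::
    "(real ^ 'd \<Rightarrow> real ^ 'd \<Rightarrow> real) \<Rightarrow> real ^ 'd \<Rightarrow> nat \<Rightarrow> (nat \<Rightarrow> real ^ 'd) \<Rightarrow> nat \<Rightarrow> real"
  where "batch_weight k x n y i = k x (y i) / (\<Sum>j=1..n. k x (y j))"

definition batch_centroid ::
    "(real ^ 'd \<Rightarrow> real ^ 'd \<Rightarrow> real) \<Rightarrow> real ^ 'd \<Rightarrow> nat \<Rightarrow> (nat \<Rightarrow> real ^ 'd) \<Rightarrow> real ^ 'd"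
  where "batch_centroid k x n y = (\<Sum>i=1..n. batch_weight k x n y i *\<^sub>R y i)"

definition plugin_correction ::
    "(real ^ 'd \<Rightarrow> real ^ 'd \<Rightarrow> real) \<Rightarrow> real ^ 'd \<Rightarrow> nat \<Rightarrow> (nat \<Rightarrow> real ^ 'd) \<Rightarrow> real ^ 'd"
  where "plugin_correction k x n y =
    (\<Sum>i=1..n. (batch_weight k x n y i)\<^sup>2 *\<^sub>R (batch_centroid k x n y - y i))"

definition abc_centroid ::
    "(real ^ 'd \<Rightarrow> real ^ 'd \<Rightarrow> real) \<Rightarrow> real ^ 'd \<Rightarrow> nat \<Rightarrow> (nat \<Rightarrow> real ^ 'd) \<Rightarrow> real ^ 'd"
  where "abc_centroid k x n y = batch_centroid k x n y - plugin_correction k x n y"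

lemma abc_centroid_alt:
  "abc_centroid k x n y =
     (1 - (\<Sum>i=1..n. (batch_weight k x n y i)\<^sup>2)) *\<^sub>R batch_centroid k x n y
     + (\<Sum>i=1..n. (batch_weight k x n y i)\<^sup>2 *\<^sub>R y i)"
  unfolding abc_centroid_def plugin_correction_def
  by (simp add: scaleR_diff_right sum_subtractf scaleR_left_diff_distrib scaleR_sum_left)

definition total_variance :: "'a measure \<Rightarrow> ('a \<Rightarrow> real ^ 'd) \<Rightarrow> real"
  where "total_variance P X = (\<integral>\<omega>. (norm (X \<omega> - (\<integral>\<omega>'. X \<omega>' \<partial>P)))\<^sup>2 \<partial>P)"

end

(* Write D for the plug-in correction, so that T_ABC = T - D. All weights alpha_i are at most
   M / (sum of the w_j), and by Hoeffding's inequality the sum of the w_j exceeds n E[w] / 2 outside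
   an event of exponentially small probability; hence E|D|^2 = O(n^-2). On the same event T - c,
   with c = E[w y] / E[w], is a sum of centred i.i.d. bounded vectors divided by something of
   order n, so Var T = O(1/n). Young's inequality 2 |Cov(T, D)| <= t Var T + Var D / t with
   t = n^(-1/2) then bounds the difference of the variances by O(n^(-3/2)). *)

theory Submission
  imports Defs "HOL-Real_Asymp.Real_Asymp"
begin

section \<open>Second moments and total variance\<close>

lemma norm_power2_eq_sum_Basis:
  fixes v :: "'b::euclidean_space"
  shows "(norm v)\<^sup>2 = (\<Sum>b\<in>Basis. (v \<bullet> b)\<^sup>2)"
  by (subst power2_norm_eq_inner, subst euclidean_inner) (simp add: power2_eq_square)

context prob_space
begin

text \<open>Expanding the square leaves only the diagonal: for distinct indices independence factors
  the mean of the product, and both factors are zero. Boundedness supplies the integrability of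
  every product.\<close>

lemma second_moment_indep_sum_real:
  fixes Z :: "nat \<Rightarrow> 'a \<Rightarrow> real"
  assumes "finite I" "indep_vars (\<lambda>_. borel) Z I"
    and bounded: "\<And>i. i \<in> I \<Longrightarrow> AE \<omega> in M. \<bar>Z i \<omega>\<bar> \<le> B"
    and centered: "\<And>i. i \<in> I \<Longrightarrow> expectation (Z i) = 0"
  shows "expectation (\<lambda>\<omega>. (\<Sum>i\<in>I. Z i \<omega>)\<^sup>2) = (\<Sum>i\<in>I. expectation (\<lambda>\<omega>. (Z i \<omega>)\<^sup>2))"
proof -
  have rv[measurable]: "Z i \<in> borel_measurable M" if "i \<in> I" for i
    using assms(2) that unfolding indep_vars_def by blast
  have int: "integrable M (Z i)" if "i \<in> I" for i
    by (rule integrable_const_bound[of _ B]) (use that bounded in auto)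
  have int2: "integrable M (\<lambda>\<omega>. Z i \<omega> * Z j \<omega>)" if "i \<in> I" "j \<in> I" for i j
  proof (rule integrable_const_bound[of _ "B * B"])
    show "AE \<omega> in M. norm (Z i \<omega> * Z j \<omega>) \<le> B * B"
      using bounded[OF that(1)] bounded[OF that(2)]
      by eventually_elim (auto simp: abs_mult intro!: mult_mono)
  qed (use that in measurable)
  have cross: "expectation (\<lambda>\<omega>. Z i \<omega> * Z j \<omega>) = 0" if "i \<in> I" "j \<in> I" "i \<noteq> j" for i j
  proof -
    \<comment> \<open>The product rule for independent families is applied to the pair; since
      \<open>i \<noteq> j\<close>, the products over \<open>{i, j}\<close> really have two
      factors.\<close>
    have "expectation (\<lambda>\<omega>. \<Prod>l\<in>{i, j}. Z l \<omega>) = (\<Prod>l\<in>{i, j}. expectation (Z l))"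
      using that int by (intro indep_vars_lebesgue_integral indep_vars_subset[OF assms(2)]) auto
    then show ?thesis
      using that centered by simp
  qed
  have "expectation (\<lambda>\<omega>. (\<Sum>i\<in>I. Z i \<omega>)\<^sup>2)
      = (\<Sum>i\<in>I. \<Sum>j\<in>I. expectation (\<lambda>\<omega>. Z i \<omega> * Z j \<omega>))"
    using int2 by (simp add: power2_eq_square sum_product Bochner_Integration.integral_sum)
  also have "\<dots> = (\<Sum>i\<in>I. \<Sum>j\<in>I. if i = j then expectation (\<lambda>\<omega>. Z i \<omega> * Z j \<omega>) else 0)"
    using cross by (intro sum.cong) auto
  also have "\<dots> = (\<Sum>i\<in>I. expectation (\<lambda>\<omega>. (Z i \<omega>)\<^sup>2))"
    using assms(1) by (simp add: power2_eq_square)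
  finally show ?thesis .
qed

text \<open>Coordinatewise reduction to the real case by Parseval: pairing with a basis vector is
  linear and does not increase the norm, so independence, centring and the bound \<open>B\<close>
  all pass to the coordinates.\<close>

lemma second_moment_indep_sum:
  fixes Z :: "nat \<Rightarrow> 'a \<Rightarrow> 'b::euclidean_space"
  assumes "finite I" "indep_vars (\<lambda>_. borel) Z I"
    and bounded: "\<And>i. i \<in> I \<Longrightarrow> AE \<omega> in M. norm (Z i \<omega>) \<le> B"
    and centered: "\<And>i. i \<in> I \<Longrightarrow> expectation (Z i) = 0"
  shows "expectation (\<lambda>\<omega>. (norm (\<Sum>i\<in>I. Z i \<omega>))\<^sup>2) = (\<Sum>i\<in>I. expectation (\<lambda>\<omega>. (norm (Z i \<omega>))\<^sup>2))"
proof -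
  have rv[measurable]: "Z i \<in> borel_measurable M" if "i \<in> I" for i
    using assms(2) that unfolding indep_vars_def by blast
  have int: "integrable M (Z i)" if "i \<in> I" for i
    by (rule integrable_const_bound[of _ B]) (use that bounded in auto)
  have bounded_inner: "AE \<omega> in M. \<bar>Z i \<omega> \<bullet> b\<bar> \<le> B" if "i \<in> I" "b \<in> Basis" for i b
    using bounded[OF that(1)] by eventually_elim (meson Basis_le_norm order_trans that(2))
  have int2: "integrable M (\<lambda>\<omega>. (Z i \<omega> \<bullet> b)\<^sup>2)" if "i \<in> I" "b \<in> Basis" for i b
  proof (rule integrable_const_bound[of _ "B\<^sup>2"])
    show "AE \<omega> in M. norm ((Z i \<omega> \<bullet> b)\<^sup>2) \<le> B\<^sup>2"
      using bounded_inner[OF that] by eventually_elim (simp add: abs_le_square_iff[symmetric])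
  qed (use that in measurable)
  \<comment> \<open>Needed to exchange the sum over \<open>Basis\<close> with the
    expectation.\<close>
  have int_sum2: "integrable M (\<lambda>\<omega>. (\<Sum>i\<in>I. Z i \<omega> \<bullet> b)\<^sup>2)" if "b \<in> Basis" for b
  proof (rule integrable_const_bound[of _ "(\<Sum>i\<in>I. B)\<^sup>2"])
    have "AE \<omega> in M. \<forall>i\<in>I. \<bar>Z i \<omega> \<bullet> b\<bar> \<le> B"
      using assms(1) bounded_inner[OF _ that] by (simp add: AE_finite_all)
    then show "AE \<omega> in M. norm ((\<Sum>i\<in>I. Z i \<omega> \<bullet> b)\<^sup>2) \<le> (\<Sum>i\<in>I. B)\<^sup>2"
    proof eventually_elim
      case (elim \<omega>)
      have "\<bar>\<Sum>i\<in>I. Z i \<omega> \<bullet> b\<bar> \<le> (\<Sum>i\<in>I. B)"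
        using elim by (intro order_trans[OF sum_abs] sum_mono) auto
      then show ?case
        by (simp add: abs_le_square_iff[symmetric])
    qed
  qed (use that in measurable)
  have "expectation (\<lambda>\<omega>. (norm (\<Sum>i\<in>I. Z i \<omega>))\<^sup>2)
      = (\<Sum>b\<in>Basis. expectation (\<lambda>\<omega>. (\<Sum>i\<in>I. Z i \<omega> \<bullet> b)\<^sup>2))"
    using int_sum2
    by (simp add: norm_power2_eq_sum_Basis inner_sum_left Bochner_Integration.integral_sum)
  also have "\<dots> = (\<Sum>b\<in>Basis. \<Sum>i\<in>I. expectation (\<lambda>\<omega>. (Z i \<omega> \<bullet> b)\<^sup>2))"
  proof (intro sum.cong refl second_moment_indep_sum_real[where B = B] assms(1))
    fix b :: 'b
    show "indep_vars (\<lambda>_. borel) (\<lambda>i \<omega>. Z i \<omega> \<bullet> b) I"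
      by (rule indep_vars_compose2[OF assms(2), where Y = "\<lambda>_ z. z \<bullet> b"]) auto
    fix i assume "i \<in> I"
    then show "expectation (\<lambda>\<omega>. Z i \<omega> \<bullet> b) = 0"
      using int centered by simp
    assume "b \<in> Basis"
    with \<open>i \<in> I\<close> show "AE \<omega> in M. \<bar>Z i \<omega> \<bullet> b\<bar> \<le> B"
      by (rule bounded_inner)
  qed
  also have "\<dots> = (\<Sum>i\<in>I. expectation (\<lambda>\<omega>. (norm (Z i \<omega>))\<^sup>2))"
    using int2
    by (subst sum.swap) (simp add: norm_power2_eq_sum_Basis Bochner_Integration.integral_sum)
  finally show ?thesis .
qed

section \<open>Variance of bounded vectors and its perturbation\<close>

lemma integrable_norm_power2_of_bounded:
  fixes X :: "'a \<Rightarrow> 'b::{banach, second_countable_topology}"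
  assumes [measurable]: "X \<in> borel_measurable M" and "AE \<omega> in M. norm (X \<omega>) \<le> B"
  shows "integrable M (\<lambda>\<omega>. (norm (X \<omega> - c))\<^sup>2)"
proof (rule integrable_const_bound[of _ "(B + norm c)\<^sup>2"])
  show "AE \<omega> in M. norm ((norm (X \<omega> - c))\<^sup>2) \<le> (B + norm c)\<^sup>2"
    using assms(2)
  proof eventually_elim
    case (elim \<omega>)
    then have "norm (X \<omega> - c) \<le> B + norm c"
      using norm_triangle_ineq4[of "X \<omega>" c] by linarith
    then show ?case
      by (simp add: power_mono)
  qed
qed measurable

text \<open>The mean minimises the mean square distance to a point, because the cross term with
  \<open>m - c\<close> integrates to zero. This allows the centroid to be compared with an explicit
  point instead of its own expectation, which has no closed form.\<close>

lemma total_variance_le: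
  fixes X :: "'a \<Rightarrow> real ^ 'd"
  assumes [measurable]: "X \<in> borel_measurable M" and "AE \<omega> in M. norm (X \<omega>) \<le> B"
  shows "total_variance M X \<le> expectation (\<lambda>\<omega>. (norm (X \<omega> - c))\<^sup>2)"
proof -
  have int: "integrable M X"
    by (rule integrable_const_bound[OF assms(2,1)])
  define m where "m = expectation X"
  have eq: "(norm (X \<omega> - c))\<^sup>2
      = (norm (X \<omega> - m))\<^sup>2 + (2 * ((X \<omega> - m) \<bullet> (m - c)) + (norm (m - c))\<^sup>2)" for \<omega>
    by (simp add: power2_norm_eq_inner inner_diff_left inner_diff_right inner_commute)
  have 0: "expectation (\<lambda>\<omega>. (X \<omega> - m) \<bullet> (m - c)) = 0"
    using int by (simp add: m_def prob_space)
  have "expectation (\<lambda>\<omega>. (norm (X \<omega> - c))\<^sup>2) = total_variance M X + (norm (m - c))\<^sup>2"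
    unfolding eq using int integrable_norm_power2_of_bounded[OF assms, of m] 0
    by (simp add: total_variance_def m_def[symmetric] prob_space)
  then show ?thesis
    by simp
qed

lemma total_variance_nonneg: "total_variance M (X :: 'a \<Rightarrow> real ^ 'd) \<ge> 0"
  by (simp add: total_variance_def)

text \<open>The free parameter \<open>t\<close> comes from Young's inequality and replaces the Cauchy--Schwarz bound
  on the covariance of \<open>X\<close> and \<open>D\<close>.\<close>

lemma total_variance_diff_le:
  fixes X D :: "'a \<Rightarrow> real ^ 'd"
  assumes X: "X \<in> borel_measurable M" "AE \<omega> in M. norm (X \<omega>) \<le> A"
    and D: "D \<in> borel_measurable M" "AE \<omega> in M. norm (D \<omega>) \<le> B"
    and "t > 0"
  shows "\<bar>total_variance M (\<lambda>\<omega>. X \<omega> - D \<omega>) - total_variance M X\<bar>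
    \<le> t * total_variance M X + (1 + 1 / t) * expectation (\<lambda>\<omega>. (norm (D \<omega>))\<^sup>2)"
proof -
  note [measurable] = X(1) D(1)
  have int: "integrable M X" "integrable M D"
    using integrable_const_bound X D by blast+
  define U where "U = (\<lambda>\<omega>. X \<omega> - expectation X)"
  define V where "V = (\<lambda>\<omega>. D \<omega> - expectation D)"
  \<comment> \<open>Centring is linear, so everything reduces to a pointwise comparison of the
    squared norms of \<open>U - V\<close> and \<open>U\<close>.\<close>
  have UV: "X \<omega> - D \<omega> - expectation (\<lambda>\<omega>. X \<omega> - D \<omega>) = U \<omega> - V \<omega>" for \<omega>
    using int by (simp add: U_def V_def)
  have "AE \<omega> in M. norm (X \<omega> - D \<omega>) \<le> A + B"
    using X(2) D(2) by eventually_elim (meson add_mono norm_triangle_ineq4 order_trans)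
  then have intUV: "integrable M (\<lambda>\<omega>. (norm (U \<omega> - V \<omega>))\<^sup>2)"
    unfolding UV[symmetric] by (intro integrable_norm_power2_of_bounded) measurable
  have intU: "integrable M (\<lambda>\<omega>. (norm (U \<omega>))\<^sup>2)" and intV: "integrable M (\<lambda>\<omega>. (norm (V \<omega>))\<^sup>2)"
    unfolding U_def V_def
    using integrable_norm_power2_of_bounded[OF X] integrable_norm_power2_of_bounded[OF D] by blast+
  have pointwise: "\<bar>(norm (U \<omega> - V \<omega>))\<^sup>2 - (norm (U \<omega>))\<^sup>2\<bar>
      \<le> t * (norm (U \<omega>))\<^sup>2 + (1 + 1 / t) * (norm (V \<omega>))\<^sup>2" for \<omega>
  proof -
    \<comment> \<open>Expanding this square gives Young's inequality. In the factor
      \<open>1 + 1 / t\<close>, the \<open>1 / t\<close> comes from here and the \<open>1\<close>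
      from the square of \<open>V\<close> itself.\<close>
    have "0 \<le> (t * norm (U \<omega>) - norm (V \<omega>))\<^sup>2 / t"
      using \<open>t > 0\<close> by simp
    then have young: "2 * (norm (U \<omega>) * norm (V \<omega>)) \<le> t * (norm (U \<omega>))\<^sup>2 + (norm (V \<omega>))\<^sup>2 / t"
      using \<open>t > 0\<close> by (simp add: power2_eq_square field_simps)
    have "(norm (U \<omega> - V \<omega>))\<^sup>2 - (norm (U \<omega>))\<^sup>2 = (norm (V \<omega>))\<^sup>2 - 2 * (U \<omega> \<bullet> V \<omega>)"
      by (simp add: power2_norm_eq_inner inner_diff_left inner_diff_right inner_commute)
    moreover have "\<bar>U \<omega> \<bullet> V \<omega>\<bar> \<le> norm (U \<omega>) * norm (V \<omega>)"
      by (rule Cauchy_Schwarz_ineq2)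
    moreover have "(1 + 1 / t) * (norm (V \<omega>))\<^sup>2 = (norm (V \<omega>))\<^sup>2 + (norm (V \<omega>))\<^sup>2 / t"
      by (simp add: algebra_simps)
    ultimately show ?thesis
      using young zero_le_power2[of "norm (V \<omega>)"] by linarith
  qed
  have "\<bar>total_variance M (\<lambda>\<omega>. X \<omega> - D \<omega>) - total_variance M X\<bar>
      = \<bar>expectation (\<lambda>\<omega>. (norm (U \<omega> - V \<omega>))\<^sup>2 - (norm (U \<omega>))\<^sup>2)\<bar>"
    using intUV intU by (simp only: total_variance_def UV) (simp add: U_def)
  also have "\<dots> \<le> expectation (\<lambda>\<omega>. \<bar>(norm (U \<omega> - V \<omega>))\<^sup>2 - (norm (U \<omega>))\<^sup>2\<bar>)"
    by (rule integral_abs_bound)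
  also have "\<dots> \<le> expectation (\<lambda>\<omega>. t * (norm (U \<omega>))\<^sup>2 + (1 + 1 / t) * (norm (V \<omega>))\<^sup>2)"
    using intUV intU intV pointwise by (intro integral_mono) auto
  also have "\<dots> = t * total_variance M X + (1 + 1 / t) * total_variance M D"
    using intU intV by (simp add: total_variance_def U_def V_def)
  also have "total_variance M D \<le> expectation (\<lambda>\<omega>. (norm (D \<omega>))\<^sup>2)"
    using total_variance_le[OF D, of 0] by simp
  finally show ?thesis
    using \<open>t > 0\<close> by (simp add: mult_left_mono)
qed

text \<open>\<open>X \<le> Y + K * indicator A\<close> holds almost surely: off \<open>A\<close> by
  comparison with \<open>Y\<close>, on \<open>A\<close> because \<open>X \<le> K\<close> and
  \<open>Y\<close> is nonnegative. It is used with \<open>Y\<close> the good bound and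
  \<open>A\<close> an event of exponentially small probability.\<close>

lemma expectation_le_off_event:
  fixes X Y :: "'a \<Rightarrow> real"
  assumes "integrable M X" "integrable M Y" "A \<in> events"
    and "AE \<omega> in M. \<omega> \<notin> A \<longrightarrow> X \<omega> \<le> Y \<omega>"
    and "AE \<omega> in M. X \<omega> \<le> K" and "AE \<omega> in M. 0 \<le> Y \<omega>"
  shows "expectation X \<le> expectation Y + K * prob A"
proof -
  have "expectation X \<le> expectation (\<lambda>\<omega>. Y \<omega> + K * indicator A \<omega>)"
  proof (intro integral_mono_AE)
    show "AE \<omega> in M. X \<omega> \<le> Y \<omega> + K * indicator A \<omega>"
      using assms(4-6) by eventually_elim (auto simp: indicator_def)
  qed (use assms in \<open>auto intro!: integrable_real_indicator simp: emeasure_eq_measure\<close>)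
  also have "\<dots> = expectation Y + K * prob A"
    using assms by (subst Bochner_Integration.integral_add) (auto simp: emeasure_eq_measure)
  finally show ?thesis .
qed

end

section \<open>Pointwise bounds on centroids and corrections\<close>

lemma batch_weight_nonneg:
  "(\<And>i. i \<in> {1..n} \<Longrightarrow> 0 \<le> k x (y i)) \<Longrightarrow> i \<in> {1..n} \<Longrightarrow> 0 \<le> batch_weight k x n y i"
  unfolding batch_weight_def by (intro divide_nonneg_nonneg sum_nonneg) auto

text \<open>The sum is 1 unless the normaliser vanishes, in which case division by zero makes it 0.
  The inequality covers both cases without any positivity condition.\<close>

lemma sum_batch_weight_le_1: "(\<Sum>i=1..n. batch_weight k x n y i) \<le> 1"
  by (simp add: batch_weight_def flip: sum_divide_distrib)

text \<open>The centroid is a combination with nonnegative coefficients of total at most 1, hence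
  stays in the ball of radius \<open>C\<close> about the origin.\<close>

lemma norm_batch_centroid_le:
  assumes "\<And>i. i \<in> {1..n} \<Longrightarrow> 0 \<le> k x (y i)" and "\<And>i. i \<in> {1..n} \<Longrightarrow> norm (y i) \<le> C" and "C \<ge> 0"
  shows "norm (batch_centroid k x n y) \<le> C"
proof -
  have "norm (batch_centroid k x n y) \<le> (\<Sum>i=1..n. batch_weight k x n y i * C)"
    unfolding batch_centroid_def using assms batch_weight_nonneg[of n k x y]
    by (intro sum_norm_le) (auto intro!: mult_mono)
  also have "\<dots> \<le> C"
    using mult_right_mono[OF sum_batch_weight_le_1[of k x n y] \<open>C \<ge> 0\<close>]
    by (simp add: sum_distrib_right)
  finally show ?thesis .
qed

text \<open>In each squared weight one factor is replaced by \<open>a\<close>; the remaining weights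
  sum to at most 1, and each difference from the centroid has norm at most \<open>2 * C\<close>.
  With \<open>a\<close> of order 1/n the correction is therefore of order 1/n.\<close>

lemma norm_plugin_correction_le:
  assumes nonneg: "\<And>i. i \<in> {1..n} \<Longrightarrow> 0 \<le> k x (y i)"
    and "\<And>i. i \<in> {1..n} \<Longrightarrow> norm (y i) \<le> C" and "C \<ge> 0"
    and "\<And>i. i \<in> {1..n} \<Longrightarrow> batch_weight k x n y i \<le> a" and "a \<ge> 0"
  shows "norm (plugin_correction k x n y) \<le> 2 * C * a"
proof -
  have "norm (plugin_correction k x n y) \<le> (\<Sum>i=1..n. (batch_weight k x n y i * a) * (2 * C))"
    unfolding plugin_correction_def
  proof (intro sum_norm_le)
    fix i assume i: "i \<in> {1..n}"
    have "norm (batch_centroid k x n y - y i) \<le> 2 * C"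
      using norm_triangle_ineq4[of "batch_centroid k x n y" "y i"]
        norm_batch_centroid_le[of n k x y C] assms(1-3) assms(2)[OF i] by auto
    moreover have "(batch_weight k x n y i)\<^sup>2 \<le> batch_weight k x n y i * a"
      using batch_weight_nonneg[of n k x y i] assms i
      by (auto simp: power2_eq_square intro!: mult_left_mono)
    ultimately show "norm ((batch_weight k x n y i)\<^sup>2 *\<^sub>R (batch_centroid k x n y - y i))
        \<le> (batch_weight k x n y i * a) * (2 * C)"
      using batch_weight_nonneg[of n k x y i] assms i by (auto intro!: mult_mono)
  qed
  also have "\<dots> = (\<Sum>i=1..n. batch_weight k x n y i) * (2 * C * a)"
    unfolding sum_distrib_right by (intro sum.cong) auto
  also have "\<dots> \<le> 1 * (2 * C * a)"
    using sum_batch_weight_le_1[of k x n y] assms by (intro mult_right_mono) auto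
  finally show ?thesis
    by simp
qed

lemma batch_weight_le_1:
  assumes "\<And>i. i \<in> {1..n} \<Longrightarrow> 0 \<le> k x (y i)" and "i \<in> {1..n}"
  shows "batch_weight k x n y i \<le> 1"
  using member_le_sum[of i "{1..n}" "batch_weight k x n y"] batch_weight_nonneg[of n k x y]
    sum_batch_weight_le_1[of k x n y] assms by (auto intro: order_trans)

lemma batch_weight_le:
  assumes "k x (y i) \<le> M" and "0 < m" and "m \<le> (\<Sum>j=1..n. k x (y j))" and "0 \<le> M"
  shows "batch_weight k x n y i \<le> M / m"
  unfolding batch_weight_def using assms by (intro frac_le) auto

text \<open>Since the normaliser is positive, the weights sum to exactly 1 and \<open>c\<close> can
  be moved inside the sum. Replacing the random denominator by \<open>m\<close> leaves a plain sum
  of functions of the single samples, to which independence applies.\<close>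

lemma norm_batch_centroid_diff_le:
  assumes "0 < m" and "m \<le> (\<Sum>j=1..n. k x (y j))"
  shows "norm (batch_centroid k x n y - c) \<le> norm (\<Sum>i=1..n. k x (y i) *\<^sub>R (y i - c)) / m"
proof -
  define W where "W = (\<Sum>j=1..n. k x (y j))"
  have "W > 0"
    using assms by (simp add: W_def)
  have "batch_centroid k x n y - c = (1 / W) *\<^sub>R (\<Sum>i=1..n. k x (y i) *\<^sub>R (y i - c))"
    using \<open>W > 0\<close>
    by (simp add: batch_centroid_def batch_weight_def W_def[symmetric] scaleR_diff_right
        sum_subtractf scaleR_sum_right divide_inverse mult.commute del: One_nat_def
        flip: scaleR_sum_left)
  then have "norm (batch_centroid k x n y - c) = norm (\<Sum>i=1..n. k x (y i) *\<^sub>R (y i - c)) / W"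
    using \<open>W > 0\<close> by simp
  also have "\<dots> \<le> norm (\<Sum>i=1..n. k x (y i) *\<^sub>R (y i - c)) / m"
    using assms by (intro frac_le) (auto simp: W_def)
  finally show ?thesis .
qed

section \<open>Expectations over i.i.d. samples\<close>

text \<open>The almost sure bounds are imposed on the generic copy \<open>y 0\<close> only;
  \<open>distr_eq\<close> carries them over to every sample.\<close>

locale minibatch = prob_space P
  for P :: "'a measure" +
  fixes y :: "nat \<Rightarrow> 'a \<Rightarrow> real ^ 'd"
    and k :: "real ^ 'd \<Rightarrow> real ^ 'd \<Rightarrow> real" and x :: "real ^ 'd" and M C :: real
  assumes kernel_measurable [measurable]: "k x \<in> borel_measurable borel"
    and indep: "indep_vars (\<lambda>_. borel) y UNIV"
    and distr_eq: "distr P borel (y i) = distr P borel (y 0)"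
    and M_pos: "M > 0" and C_pos: "C > 0"
    and AE_weight: "AE \<omega> in P. k x (y 0 \<omega>) \<in> {0..M}"
    and AE_norm: "AE \<omega> in P. norm (y 0 \<omega>) \<le> C"
    and mean_weight_pos: "(\<integral>\<omega>. k x (y 0 \<omega>) \<partial>P) > 0"
begin

definition mean_weight :: real
  where "mean_weight = (\<integral>\<omega>. k x (y 0 \<omega>) \<partial>P)"

text \<open>The ratio E[w y] / E[w], the unique point \<open>c\<close> for which w (y - c) has mean
  zero.\<close>

definition weighted_mean :: "real ^ 'd"
  where "weighted_mean = (1 / mean_weight) *\<^sub>R (\<integral>\<omega>. k x (y 0 \<omega>) *\<^sub>R y 0 \<omega> \<partial>P)"

text \<open>The exceptional event: the normaliser is at most half its expectation. Off it,
  denominators are of order n.\<close>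

definition low_weight :: "nat \<Rightarrow> 'a set"
  where "low_weight n = {\<omega> \<in> space P. (\<Sum>i=1..n. k x (y i \<omega>)) \<le> real n * mean_weight / 2}"

lemma mean_weight_gt_0: "mean_weight > 0"
  using mean_weight_pos by (simp add: mean_weight_def)

lemma sample_measurable [measurable]: "y i \<in> borel_measurable P"
  using indep unfolding indep_vars_def by blast

lemma AE_sample:
  assumes [measurable]: "Measurable.pred borel Q" and "AE \<omega> in P. Q (y 0 \<omega>)"
  shows "AE \<omega> in P. Q (y i \<omega>)"
proof -
  have "AE z in distr P borel (y i). Q z"
    unfolding distr_eq[of i] using assms by (subst AE_distr_iff) measurable
  then show ?thesis
    by (subst (asm) AE_distr_iff) measurable
qed

lemma expectation_sample:
  fixes g :: "real ^ 'd \<Rightarrow> 'b::{banach, second_countable_topology}"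
  assumes [measurable]: "g \<in> borel_measurable borel"
  shows "expectation (\<lambda>\<omega>. g (y i \<omega>)) = expectation (\<lambda>\<omega>. g (y 0 \<omega>))"
proof -
  have "expectation (\<lambda>\<omega>. g (y i \<omega>)) = integral\<^sup>L (distr P borel (y i)) g"
    by (rule integral_distr[symmetric]) measurable
  also have "\<dots> = expectation (\<lambda>\<omega>. g (y 0 \<omega>))"
    unfolding distr_eq[of i] by (rule integral_distr) measurable
  finally show ?thesis .
qed

lemma AE_weight_sample: "AE \<omega> in P. k x (y i \<omega>) \<in> {0..M}"
  by (rule AE_sample[OF _ AE_weight]) measurable

lemma AE_norm_sample: "AE \<omega> in P. norm (y i \<omega>) \<le> C"
  by (rule AE_sample[OF _ AE_norm]) measurable

lemma AE_samples: "AE \<omega> in P. \<forall>i. k x (y i \<omega>) \<in> {0..M} \<and> norm (y i \<omega>) \<le> C"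
  using AE_weight_sample AE_norm_sample by (simp add: AE_all_countable)

section \<open>Lower tail of the normalising sum\<close>

lemma low_weight_event [measurable]: "low_weight n \<in> events"
  unfolding low_weight_def by measurable

text \<open>Hoeffding's lower tail with n variables in an interval of length \<open>M\<close> and
  deviation \<open>n * mean_weight / 2\<close>; the exponent simplifies to a fixed negative multiple
  of n.\<close>

lemma prob_low_weight_le:
  assumes "n > 0"
  shows "prob (low_weight n) \<le> exp (- (mean_weight\<^sup>2 / (2 * M\<^sup>2)) * real n)"
proof -
  interpret Hoeffding_ineq P "{1..n}" "\<lambda>i \<omega>. k x (y i \<omega>)" "\<lambda>_. 0" "\<lambda>_. M"
    "\<Sum>i\<in>{1..n}. expectation (\<lambda>\<omega>. k x (y i \<omega>))"
  proof unfold_locales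
    show "indep_vars (\<lambda>_. borel) (\<lambda>i \<omega>. k x (y i \<omega>)) {1..n}"
      by (rule indep_vars_compose2[OF indep_vars_subset[OF indep], where Y = "\<lambda>_. k x"]) auto
  qed (use AE_weight_sample in auto)
  have mean: "expectation (\<lambda>\<omega>. k x (y i \<omega>)) = mean_weight" for i
    unfolding mean_weight_def by (rule expectation_sample) measurable
  have "low_weight n = {\<omega> \<in> space P. (\<Sum>i=1..n. k x (y i \<omega>))
      \<le> (\<Sum>i\<in>{1..n}. expectation (\<lambda>\<omega>. k x (y i \<omega>))) - real n * mean_weight / 2}"
    by (simp add: low_weight_def mean)
  then have "prob (low_weight n)
      \<le> exp (- 2 * (real n * mean_weight / 2)\<^sup>2 / (\<Sum>i\<in>{1..n}. (M - 0)\<^sup>2))"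
    using Hoeffding_ineq_le[of "real n * mean_weight / 2"] assms M_pos mean_weight_gt_0 by simp
  also have "- 2 * (real n * mean_weight / 2)\<^sup>2 / (\<Sum>i\<in>{1..n}. (M - 0)\<^sup>2)
      = - (mean_weight\<^sup>2 / (2 * M\<^sup>2)) * real n"
    using assms M_pos by (simp add: field_simps power2_eq_square)
  finally show ?thesis .
qed

section \<open>Moment bounds for the random centroid and its correction\<close>

abbreviation centroid :: "nat \<Rightarrow> 'a \<Rightarrow> real ^ 'd"
  where "centroid n \<omega> \<equiv> batch_centroid k x n (\<lambda>i. y i \<omega>)"

abbreviation correction :: "nat \<Rightarrow> 'a \<Rightarrow> real ^ 'd"
  where "correction n \<omega> \<equiv> plugin_correction k x n (\<lambda>i. y i \<omega>)"

lemma centroid_measurable [measurable]: "centroid n \<in> borel_measurable P"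
  unfolding batch_centroid_def batch_weight_def by measurable

lemma correction_measurable [measurable]: "correction n \<in> borel_measurable P"
  unfolding plugin_correction_def batch_weight_def by measurable

lemma AE_norm_centroid: "AE \<omega> in P. norm (centroid n \<omega>) \<le> C"
  using AE_samples by eventually_elim (rule norm_batch_centroid_le, use C_pos in auto)

lemma AE_norm_correction: "AE \<omega> in P. norm (correction n \<omega>) \<le> 2 * C"
  using AE_samples
proof eventually_elim
  case (elim \<omega>)
  then have "norm (correction n \<omega>) \<le> 2 * C * 1"
    using C_pos by (intro norm_plugin_correction_le batch_weight_le_1) auto
  then show ?case
    by simp
qed

text \<open>Off \<open>low_weight n\<close> every weight is at most
  \<open>2 * M / (n * mean_weight)\<close>, so the correction has norm at most
  \<open>4 * C * M / (n * mean_weight)\<close>. On \<open>low_weight n\<close> the crude bound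
  \<open>2 * C\<close> suffices.\<close>

lemma expectation_norm_correction_le:
  assumes "n > 0"
  shows "expectation (\<lambda>\<omega>. (norm (correction n \<omega>))\<^sup>2)
    \<le> (4 * C * M / (real n * mean_weight))\<^sup>2 + (2 * C)\<^sup>2 * prob (low_weight n)"
proof -
  have "expectation (\<lambda>\<omega>. (norm (correction n \<omega>))\<^sup>2)
      \<le> expectation (\<lambda>\<omega>. (4 * C * M / (real n * mean_weight))\<^sup>2) + (2 * C)\<^sup>2 * prob (low_weight n)"
  proof (rule expectation_le_off_event)
    show "integrable P (\<lambda>\<omega>. (norm (correction n \<omega>))\<^sup>2)"
      using integrable_norm_power2_of_bounded[OF correction_measurable AE_norm_correction, of n 0]
      by simp
    show "AE \<omega> in P. \<omega> \<notin> low_weight n \<longrightarrow>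
        (norm (correction n \<omega>))\<^sup>2 \<le> (4 * C * M / (real n * mean_weight))\<^sup>2"
      using AE_samples AE_space
    proof eventually_elim
      case (elim \<omega>)
      show ?case
      proof
        assume "\<omega> \<notin> low_weight n"
        then have *: "real n * mean_weight / 2 \<le> (\<Sum>i=1..n. k x (y i \<omega>))"
          using elim by (simp add: low_weight_def)
        have "norm (correction n \<omega>) \<le> 2 * C * (M / (real n * mean_weight / 2))"
          using * elim C_pos M_pos mean_weight_gt_0 assms
          by (intro norm_plugin_correction_le batch_weight_le) auto
        then show "(norm (correction n \<omega>))\<^sup>2 \<le> (4 * C * M / (real n * mean_weight))\<^sup>2"
          by (intro power_mono) (auto simp: mult_ac)
      qed
    qed
    show "AE \<omega> in P. (norm (correction n \<omega>))\<^sup>2 \<le> (2 * C)\<^sup>2"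
      using AE_norm_correction by eventually_elim (intro power_mono, auto)
  qed auto
  then show ?thesis
    by (simp add: prob_space)
qed

text \<open>The summands are independent, bounded and, by the choice of
  \<open>weighted_mean\<close>, centred, so the second moment grows linearly in n rather than
  quadratically.\<close>

lemma second_moment_centered_sum_le:
  "expectation (\<lambda>\<omega>. (norm (\<Sum>i=1..n. k x (y i \<omega>) *\<^sub>R (y i \<omega> - weighted_mean)))\<^sup>2)
    \<le> real n * (M * (C + norm weighted_mean))\<^sup>2"
proof -
  define Z where "Z = (\<lambda>i \<omega>. k x (y i \<omega>) *\<^sub>R (y i \<omega> - weighted_mean))"
  have [measurable]: "Z i \<in> borel_measurable P" for i
    unfolding Z_def by measurable
  have bounded: "AE \<omega> in P. norm (Z i \<omega>) \<le> M * (C + norm weighted_mean)" for i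
    using AE_samples
  proof eventually_elim
    case (elim \<omega>)
    have "norm (y i \<omega> - weighted_mean) \<le> C + norm weighted_mean"
      using elim norm_triangle_ineq4[of "y i \<omega>" weighted_mean]
      by (meson add_right_mono order_trans)
    then show ?case
      using elim M_pos by (auto simp: Z_def intro!: mult_mono)
  qed
  have int_weight: "integrable P (\<lambda>\<omega>. k x (y 0 \<omega>))"
    by (rule integrable_const_bound[of _ M]) (use AE_weight in auto)
  have int_weighted: "integrable P (\<lambda>\<omega>. k x (y 0 \<omega>) *\<^sub>R y 0 \<omega>)"
  proof (rule integrable_const_bound[of _ "M * C"])
    show "AE \<omega> in P. norm (k x (y 0 \<omega>) *\<^sub>R y 0 \<omega>) \<le> M * C"
      using AE_weight AE_norm by eventually_elim (auto intro!: mult_mono)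
  qed measurable
  \<comment> \<open>This is E[w y] - E[w] c with c = \<open>weighted_mean\<close>;
    \<open>mean_weight > 0\<close> permits the cancellation.\<close>
  have "expectation (Z 0) = 0"
    using int_weight int_weighted mean_weight_gt_0
    by (simp add: Z_def scaleR_diff_right weighted_mean_def mean_weight_def[symmetric])
  moreover have "expectation (Z i) = expectation (Z 0)" for i
    unfolding Z_def by (rule expectation_sample[of "\<lambda>z. k x z *\<^sub>R (z - weighted_mean)"]) measurable
  ultimately have centered: "expectation (Z i) = 0" for i
    by simp
  have "indep_vars (\<lambda>_. borel) Z {1..n}"
    unfolding Z_def
    by (rule indep_vars_compose2[OF indep_vars_subset[OF indep],
          where Y = "\<lambda>_ z. k x z *\<^sub>R (z - weighted_mean)"]) auto
  then have "expectation (\<lambda>\<omega>. (norm (\<Sum>i=1..n. Z i \<omega>))\<^sup>2)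
      = (\<Sum>i=1..n. expectation (\<lambda>\<omega>. (norm (Z i \<omega>))\<^sup>2))"
    by (intro second_moment_indep_sum[OF _ _ bounded centered]) auto
  also have "\<dots> \<le> (\<Sum>i=1..n. (M * (C + norm weighted_mean))\<^sup>2)"
  proof (rule sum_mono)
    fix i
    have "expectation (\<lambda>\<omega>. (norm (Z i \<omega>))\<^sup>2) \<le> expectation (\<lambda>\<omega>. (M * (C + norm weighted_mean))\<^sup>2)"
    proof (rule integral_mono_AE)
      show "integrable P (\<lambda>\<omega>. (norm (Z i \<omega>))\<^sup>2)"
        using integrable_norm_power2_of_bounded[OF _ bounded, of i 0] by simp
      show "AE \<omega> in P. (norm (Z i \<omega>))\<^sup>2 \<le> (M * (C + norm weighted_mean))\<^sup>2"
        using bounded[of i] by eventually_elim (intro power_mono, auto)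
    qed simp
    then show "expectation (\<lambda>\<omega>. (norm (Z i \<omega>))\<^sup>2) \<le> (M * (C + norm weighted_mean))\<^sup>2"
      by (simp add: prob_space)
  qed
  finally show ?thesis
    by (simp add: Z_def)
qed

lemma integrable_second_moment_centered_sum:
  "integrable P (\<lambda>\<omega>. (norm (\<Sum>i=1..n. k x (y i \<omega>) *\<^sub>R (y i \<omega> - c)))\<^sup>2)"
proof (rule integrable_const_bound[of _ "(\<Sum>i=1..n. M * (C + norm c))\<^sup>2"])
  show "AE \<omega> in P. norm ((norm (\<Sum>i=1..n. k x (y i \<omega>) *\<^sub>R (y i \<omega> - c)))\<^sup>2)
      \<le> (\<Sum>i=1..n. M * (C + norm c))\<^sup>2"
    using AE_samples
  proof eventually_elim
    case (elim \<omega>)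
    have "norm (k x (y i \<omega>) *\<^sub>R (y i \<omega> - c)) \<le> M * (C + norm c)" for i
    proof -
      have "norm (y i \<omega> - c) \<le> C + norm c"
        using elim norm_triangle_ineq4[of "y i \<omega>" c] by (meson add_right_mono order_trans)
      then show ?thesis
        using elim M_pos by (auto intro!: mult_mono)
    qed
    then have "norm (\<Sum>i=1..n. k x (y i \<omega>) *\<^sub>R (y i \<omega> - c)) \<le> (\<Sum>i=1..n. M * (C + norm c))"
      by (intro sum_norm_le)
    then show ?case
      by (simp add: power_mono del: sum_constant)
  qed
qed measurable

text \<open>Off \<open>low_weight n\<close> the deviation from \<open>weighted_mean\<close> is at
  most \<open>S / m\<close> with \<open>m\<close> of order n, and the second moment of
  \<open>S\<close> is of order n, which leaves order 1/n. On \<open>low_weight n\<close> the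
  centroid is merely bounded.\<close>

lemma total_variance_centroid_le:
  assumes "n > 0"
  shows "total_variance P (centroid n)
    \<le> (2 * M * (C + norm weighted_mean) / mean_weight)\<^sup>2 / real n
      + (C + norm weighted_mean)\<^sup>2 * prob (low_weight n)"
proof -
  define S where "S = (\<lambda>\<omega>. norm (\<Sum>i=1..n. k x (y i \<omega>) *\<^sub>R (y i \<omega> - weighted_mean)))"
  \<comment> \<open>The threshold in \<open>low_weight n\<close>, hence a lower bound for the
    normaliser off that event.\<close>
  define m where "m = real n * mean_weight / 2"
  have "m > 0"
    using assms mean_weight_gt_0 by (simp add: m_def)
  have intS: "integrable P (\<lambda>\<omega>. (S \<omega>)\<^sup>2)"
    unfolding S_def by (rule integrable_second_moment_centered_sum)
  have "total_variance P (centroid n) \<le> expectation (\<lambda>\<omega>. (norm (centroid n \<omega> - weighted_mean))\<^sup>2)"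
    by (rule total_variance_le[OF centroid_measurable AE_norm_centroid])
  also have "\<dots> \<le> expectation (\<lambda>\<omega>. (S \<omega>)\<^sup>2 / m\<^sup>2) + (C + norm weighted_mean)\<^sup>2 * prob (low_weight n)"
  proof (rule expectation_le_off_event)
    show "integrable P (\<lambda>\<omega>. (norm (centroid n \<omega> - weighted_mean))\<^sup>2)"
      by (rule integrable_norm_power2_of_bounded[OF centroid_measurable AE_norm_centroid])
    show "AE \<omega> in P. \<omega> \<notin> low_weight n \<longrightarrow>
        (norm (centroid n \<omega> - weighted_mean))\<^sup>2 \<le> (S \<omega>)\<^sup>2 / m\<^sup>2"
      using AE_space
    proof eventually_elim
      case (elim \<omega>)
      show ?case
      proof
        assume "\<omega> \<notin> low_weight n"
        then have "m \<le> (\<Sum>i=1..n. k x (y i \<omega>))"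
          using elim by (simp add: low_weight_def m_def)
        then have "norm (centroid n \<omega> - weighted_mean) \<le> S \<omega> / m"
          unfolding S_def using \<open>m > 0\<close> by (rule norm_batch_centroid_diff_le[rotated])
        then show "(norm (centroid n \<omega> - weighted_mean))\<^sup>2 \<le> (S \<omega>)\<^sup>2 / m\<^sup>2"
          by (simp add: power_mono flip: power_divide)
      qed
    qed
    show "AE \<omega> in P. (norm (centroid n \<omega> - weighted_mean))\<^sup>2 \<le> (C + norm weighted_mean)\<^sup>2"
      using AE_norm_centroid[of n]
      by eventually_elim
        (intro power_mono norm_ge_zero, meson add_right_mono norm_triangle_ineq4 order_trans)
  qed (use intS in auto)
  also have "expectation (\<lambda>\<omega>. (S \<omega>)\<^sup>2 / m\<^sup>2) \<le> real n * (M * (C + norm weighted_mean))\<^sup>2 / m\<^sup>2"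
    using second_moment_centered_sum_le[of n] by (simp add: S_def divide_right_mono)
  also have "\<dots> = (2 * M * (C + norm weighted_mean) / mean_weight)\<^sup>2 / real n"
    using assms mean_weight_gt_0 by (simp add: m_def field_simps power2_eq_square)
  finally show ?thesis
    by simp
qed

section \<open>Asymptotic rates of the variances\<close>

lemma variance_asymptotics:
  shows "(\<lambda>n. total_variance P (\<lambda>\<omega>. centroid n \<omega> - correction n \<omega>) - total_variance P (centroid n))
      \<in> O(\<lambda>n. real n powr (- 3 / 2))" (is ?diff)
    and "(\<lambda>n. total_variance P (centroid n)) \<in> O(\<lambda>n. 1 / real n)" (is ?var)
proof -
  define a where "a = mean_weight\<^sup>2 / (2 * M\<^sup>2)"
  define A where "A = (2 * M * (C + norm weighted_mean) / mean_weight)\<^sup>2"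
  define B where "B = (C + norm weighted_mean)\<^sup>2"
  define A' where "A' = (4 * C * M / mean_weight)\<^sup>2"
  define B' where "B' = (2 * C)\<^sup>2"
  \<comment> \<open>\<open>V\<close> and \<open>E\<close> are explicit majorants of the variance of
    the centroid and of the second moment of the correction, with the Hoeffding bound in place of
    the probability of \<open>low_weight n\<close>.\<close>
  define V where "V = (\<lambda>n::nat. A / real n + B * exp (- a * real n))"
  define E where "E = (\<lambda>n::nat. A' / (real n)\<^sup>2 + B' * exp (- a * real n))"
  have "a > 0"
    using mean_weight_gt_0 M_pos by (simp add: a_def)
  have V: "total_variance P (centroid n) \<le> V n" if "n > 0" for n
  proof -
    have "B * prob (low_weight n) \<le> B * exp (- a * real n)"
      using prob_low_weight_le[OF that] by (intro mult_left_mono) (auto simp: a_def B_def)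
    then show ?thesis
      using total_variance_centroid_le[OF that] by (simp add: V_def A_def B_def)
  qed
  have E: "expectation (\<lambda>\<omega>. (norm (correction n \<omega>))\<^sup>2) \<le> E n" if "n > 0" for n
  proof -
    have "B' * prob (low_weight n) \<le> B' * exp (- a * real n)"
      using prob_low_weight_le[OF that] by (intro mult_left_mono) (auto simp: a_def B'_def)
    then show ?thesis
      using expectation_norm_correction_le[OF that]
      by (simp add: E_def A'_def B'_def power_divide power_mult_distrib mult_ac)
  qed
  \<comment> \<open>Exponential decay beats every power, so the exceptional event does not affect
    either rate; the exponents used are 2 for \<open>E\<close> and 1 for \<open>V\<close>.\<close>
  have exp_bigo: "(\<lambda>n. exp (- a * real n)) \<in> O(\<lambda>n. 1 / real n ^ j)" for j
    using \<open>a > 0\<close> by real_asymp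
  have E_bigo: "E \<in> O(\<lambda>n. 1 / (real n)\<^sup>2)"
    unfolding E_def using exp_bigo[of 2]
    by (intro sum_in_bigo(1)) (auto intro: bigoI[of _ "\<bar>A'\<bar>"])
  have "(\<lambda>n. total_variance P (centroid n)) \<in> O(V)"
  proof (intro landau_o.big_mono eventually_mono[OF eventually_gt_at_top[of 0]])
    fix n :: nat assume "n > 0"
    then show "norm (total_variance P (centroid n)) \<le> norm (V n)"
      using V[of n] total_variance_nonneg[of "centroid n"] by simp
  qed
  also have V_bigo: "V \<in> O(\<lambda>n. 1 / real n)"
    unfolding V_def using exp_bigo[of 1]
    by (intro sum_in_bigo(1)) (auto intro: bigoI[of _ "\<bar>A\<bar>"])
  finally show ?var .
  \<comment> \<open>The choice t = n^(-1/2) balances the two terms: t times 1/n and 1/t times 1/n^2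
    are both n^(-3/2).\<close>
  let ?diff_bound = "\<lambda>n. real n powr (- 1 / 2) * V n + (1 + real n powr (1 / 2)) * E n"
  have "\<bar>total_variance P (\<lambda>\<omega>. centroid n \<omega> - correction n \<omega>) - total_variance P (centroid n)\<bar>
      \<le> ?diff_bound n" if "n > 0" for n
  proof -
    define t where "t = real n powr (- 1 / 2)"
    have "t > 0" and inv: "1 / t = real n powr (1 / 2)"
      using that by (auto simp: t_def powr_minus_divide)
    have "\<bar>total_variance P (\<lambda>\<omega>. centroid n \<omega> - correction n \<omega>) - total_variance P (centroid n)\<bar>
        \<le> t * total_variance P (centroid n)
          + (1 + 1 / t) * expectation (\<lambda>\<omega>. (norm (correction n \<omega>))\<^sup>2)"
      by (rule total_variance_diff_le[OF centroid_measurable AE_norm_centroid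
            correction_measurable AE_norm_correction \<open>t > 0\<close>])
    also have "\<dots> \<le> t * V n + (1 + 1 / t) * E n"
      using V[OF that] E[OF that] \<open>t > 0\<close> by (intro add_mono mult_left_mono) auto
    finally show ?thesis
      unfolding inv unfolding t_def .
  qed
  then have "(\<lambda>n. total_variance P (\<lambda>\<omega>. centroid n \<omega> - correction n \<omega>) - total_variance P (centroid n))
      \<in> O(?diff_bound)"
    by (intro landau_o.big_mono eventually_mono[OF eventually_gt_at_top[of 0]])
      (auto intro: order_trans[OF _ abs_ge_self])
  also have "?diff_bound \<in> O(\<lambda>n. real n powr (- 3 / 2))"
  proof (rule sum_in_bigo(1))
    have "(\<lambda>n. real n powr (- 1 / 2) * V n) \<in> O(\<lambda>n. real n powr (- 1 / 2) * (1 / real n))"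
      by (intro landau_o.big.mult V_bigo) simp
    also have "(\<lambda>n. real n powr (- 1 / 2) * (1 / real n)) \<in> O(\<lambda>n. real n powr (- 3 / 2))"
      by real_asymp
    finally show "(\<lambda>n. real n powr (- 1 / 2) * V n) \<in> O(\<lambda>n. real n powr (- 3 / 2))" .
    have "(\<lambda>n. (1 + real n powr (1 / 2)) * E n)
        \<in> O(\<lambda>n. (1 + real n powr (1 / 2)) * (1 / (real n)\<^sup>2))"
      by (intro landau_o.big.mult E_bigo) simp
    also have "(\<lambda>n. (1 + real n powr (1 / 2)) * (1 / (real n)\<^sup>2)) \<in> O(\<lambda>n. real n powr (- 3 / 2))"
      by real_asymp
    finally show "(\<lambda>n. (1 + real n powr (1 / 2)) * E n) \<in> O(\<lambda>n. real n powr (- 3 / 2))" .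
  qed
  finally show ?diff .
qed

end

theorem proposition4p3:
  fixes p :: "(real ^ 'd) measure"
    and P :: "'a measure"
    and y :: "nat \<Rightarrow> 'a \<Rightarrow> real ^ 'd"
    and k :: "real ^ 'd \<Rightarrow> real ^ 'd \<Rightarrow> real"
    and x :: "real ^ 'd"
    and w :: "'a \<Rightarrow> real"
    and M C :: real
    and T T_ABC :: "nat \<Rightarrow> 'a \<Rightarrow> real ^ 'd"
  assumes "prob_space p" and "sets p = sets borel"
    and "k x \<in> borel_measurable borel"
    and "prob_space P"
    \<comment> \<open>\<open>y 0\<close> is the generic copy and \<open>y 1, y 2, \<dots>\<close> are the samples\<close>
    and "prob_space.indep_vars P (\<lambda>_. borel) y UNIV"
    and "\<And>i. distr P borel (y i) = p"
    and "M > 0" and "C > 0"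
  defines "w \<equiv> \<lambda>\<omega>. k x (y 0 \<omega>)"
  assumes "AE \<omega> in P. w \<omega> \<in> {0..M}"
    and "AE \<omega> in P. norm (y 0 \<omega>) \<le> C"
    and "\<P>(\<omega> in P. w \<omega> > 0) = 1"
    and "(\<integral>\<omega>. w \<omega> \<partial>P) > 0"
  defines "T \<equiv> \<lambda>n \<omega>. batch_centroid k x n (\<lambda>i. y i \<omega>)"
    and "T_ABC \<equiv> \<lambda>n \<omega>. abc_centroid k x n (\<lambda>i. y i \<omega>)"
  shows "(\<lambda>n. total_variance P (T_ABC n) - total_variance P (T n))
           \<in> O(\<lambda>n. real n powr (- 3 / 2))
         \<and> (\<lambda>n. total_variance P (T n)) \<in> O(\<lambda>n. 1 / real n)
         \<and> (\<lambda>n. total_variance P (T_ABC n)) \<in> O(\<lambda>n. 1 / real n)"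
proof -
  interpret prob_space P
    by fact
  interpret minibatch P y k x M C
    using assms by unfold_locales (simp_all add: w_def)
  have T_ABC: "T_ABC n = (\<lambda>\<omega>. T n \<omega> - plugin_correction k x n (\<lambda>i. y i \<omega>))" for n
    by (simp add: T_ABC_def T_def abc_centroid_def)
  have diff: "(\<lambda>n. total_variance P (T_ABC n) - total_variance P (T n)) \<in> O(\<lambda>n. real n powr (- 3 / 2))"
    and var: "(\<lambda>n. total_variance P (T n)) \<in> O(\<lambda>n. 1 / real n)"
    using variance_asymptotics by (simp_all add: T_ABC T_def)
  \<comment> \<open>The difference of the variances is thus absorbed into order 1/n, and adding back
    the variance of \<open>T n\<close> gives the rate for \<open>T_ABC n\<close>.\<close>
  have "(\<lambda>n. real n powr (- 3 / 2)) \<in> O(\<lambda>n. 1 / real n)"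
    by real_asymp
  then have "(\<lambda>n. (total_variance P (T_ABC n) - total_variance P (T n)) + total_variance P (T n))
      \<in> O(\<lambda>n. 1 / real n)"
    using diff var by (intro sum_in_bigo landau_o.big_trans[OF diff])
  with diff var show ?thesis
    by simp
qed

end
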